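(* Let $\ell=\ell(A,D):\mathfrak d(\mathbb M)\times\operatorname{Den}_d(\mathbb M)\to\mathbb R$ be a (smooth) semidiscrete Lagrangian. Let $A(t)\in\mathcal S\cap\mathcal R$ and $D(t)\in\operatorname{Den}_d(\mathbb M)$, $t\in[0,T]$, be (smooth) curves. Then $A(t),D(t)$ are critical for the Euler-Poincar\'e-d'Alembert variational principle $$\delta\int_0^T\ell(A,D)\,dt=0$$ with respect to variations of the form $\delta A=\partial_tB+[B,A]$, $\delta D=-\Omega^{-1}B^{\mathsf T}\Omega D$, where $B(t)\in\mathcal S\cap\mathcal R$ is an arbitrary curve with $B(0)=B(T)=0$, if and only if $$\mathbf P\left(\frac{d}{dt}\frac{\delta\ell}{\delta A}+\Omega^{-1}\Big[A^{\mathsf T},\Omega\frac{\delta\ell}{\delta A}\Big]+D\,\frac{\delta\ell}{\delta D}^{\mathsf T}\right)_{ij}=0\qquad\text{for all } i\in N(j).$$ Moreover, when $D(t)=D_0\cdot q(t)^{-1}=\Omega^{-1}q(t)^{-\mathsf T}\Omega D_0$ and $A(t)=\dot q(t)q(t)^{-1}$ for a curve $q(t)\in\mathsf D(\mathbb M)$, the semidiscrete continuity equation holds: $$\frac{d}{dt}D+\Omega^{-1}A^{\mathsf T}\Omega D=0.$$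
   Context: $\mathbb M$ is a mesh with $N$ cells $C_1,\dots,C_N$; $\Omega$ is the $N\times N$ diagonal matrix with positive entries $\Omega_{ii}=\operatorname{Vol}(C_i)$; $N(i)$ is the set of indices (including $i$ itself) of cells sharing a hyperface with $C_i$ (so $j\in N(i)\iff i\in N(j)$). $\mathbf 1=(1,\dots,1)^{\mathsf T}$. $\mathsf D(\mathbb M)=\{q\in\operatorname{GL}(N)^+: q\mathbf 1=\mathbf 1\}$ (real invertible matrices with positive determinant), with Lie algebra $\mathfrak d(\mathbb M)=\{A\in\mathfrak{gl}(N):A\mathbf 1=0\}$. The constraints are $\mathcal S=\{A\in\mathfrak d(\mathbb M):A_{ij}=0\text{ for all }j\notin N(i)\}$ and $\mathcal R=\{A\in\mathfrak d(\mathbb M):A^{\mathsf T}\Omega+\Omega A\text{ is diagonal}\}$. The space of discrete functions is $\Omega^0_d(\mathbb M)=\mathbb R^N$; the space of discrete densities $\operatorname{Den}_d(\mathbb M)=\mathbb R^N$ is its dual with respect to $\langle F,G\rangle_0=F^{\mathsf T}\Omega G$. The right action on densities is $D\cdot q=\Omega^{-1}q^{\mathsf T}\Omega D$. On $\mathfrak{gl}(N)$ use the pairing $\langle L,A\rangle=\operatorname{Tr}(L^{\mathsf T}\Omega A)$; with respect to it $\mathfrak d(\mathbb M)^*$ is identified with the matrices with zero diagonal. The functional derivatives $\frac{\delta\ell}{\delta A}\in\mathfrak d(\mathbb M)^*$ and $\frac{\delta\ell}{\delta D}\in\Omega^0_d(\mathbb M)$ are defined by $\langle\frac{\delta\ell}{\delta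 A},\delta A\rangle=\frac{d}{d\varepsilon}|_{\varepsilon=0}\ell(A+\varepsilon\delta A,D)$ and $\langle\frac{\delta\ell}{\delta D},\delta D\rangle_0=\frac{d}{d\varepsilon}|_{\varepsilon=0}\ell(A,D+\varepsilon\delta D)$ for all $\delta A\in\mathfrak d(\mathbb M)$, $\delta D\in\mathbb R^N$. $\Omega^1_d(\mathbb M)=\mathfrak{so}(N)$ denotes the skew-symmetric $N\times N$ matrices (discrete one-forms), and $\mathbf P:\mathfrak{gl}(N)\to\Omega^1_d(\mathbb M)$ is $\mathbf P(L)=(L-\widehat L)^{(A)}$, where $\widehat L_{ij}:=L_{ii}$ and $L^{(A)}:=\frac12(L-L^{\mathsf T})$. $[X,Y]=XY-YX$ is the matrix commutator. $D\,\frac{\delta\ell}{\delta D}^{\mathsf T}$ is the $N\times N$ matrix with entries $D_i(\frac{\delta\ell}{\delta D})_j$. "Critical" means that for every curve $B(t)\in\mathcal S\cap\mathcal R$ with $B(0)=B(T)=0$, $\int_0^T\big(\langle\frac{\delta\ell}{\delta A},\partial_tB+[B,A]\rangle+\langle\frac{\delta\ell}{\delta D},-\Omega^{-1}B^{\mathsf T}\Omega D\rangle_0\big)dt=0$. *)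

theory Defs
  imports "HOL-Analysis.Analysis"
begin

section \<open>Smooth maps on possibly non-open sets\<close>

text \<open>
  Existence of continuous iterated directional derivatives up to order \<open>k\<close>. It is used for closed
  intervals (where derivatives at the end points are one-sided) and for linear subspaces. On a
  linear subspace only the values of \<open>f' x\<close> on the subspace are determined by \<open>f\<close>; demanding the
  condition for all \<open>v\<close> is no restriction, since \<open>f' x\<close> may be precomposed with a projection.
\<close>

primrec Ck_on :: "nat \<Rightarrow> 'a::euclidean_space set \<Rightarrow> ('a \<Rightarrow> 'b::euclidean_space) \<Rightarrow> bool" where
  "Ck_on 0 S f \<longleftrightarrow> continuous_on S f"
| "Ck_on (Suc k) S f \<longleftrightarrow>
     (\<exists>f'. (\<forall>x\<in>S. (f has_derivative f' x) (at x within S)) \<and> (\<forall>v. Ck_on k S (\<lambda>x. f' x v)))"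

definition smooth_on :: "'a::euclidean_space set \<Rightarrow> ('a \<Rightarrow> 'b::euclidean_space) \<Rightarrow> bool" where
  "smooth_on S f \<longleftrightarrow> (\<forall>k. Ck_on k S f)"

section \<open>Meshes\<close>

text \<open>
  The cells are indexed by a finite type \<open>'n\<close>, so that the number of cells is \<open>CARD('n)\<close>. Nothing is
  assumed about the shape of the cells or about the ambient space: only the volumes of the cells
  and the incidence of their hyperfaces matter.
\<close>

record ('x, 'n) mesh =
  cell :: "'n \<Rightarrow> 'x set"
  hyperfaces :: "'n \<Rightarrow> 'x set set"
  volume_measure :: "'x measure"

definition is_mesh :: "('x, 'n::finite) mesh \<Rightarrow> bool" where
  "is_mesh M \<longleftrightarrow>
     (\<forall>i. cell M i \<in> sets (volume_measure M) \<and>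
          0 < emeasure (volume_measure M) (cell M i) \<and>
          emeasure (volume_measure M) (cell M i) < \<infinity>) \<and>
     (\<forall>i j. i \<noteq> j \<longrightarrow> emeasure (volume_measure M) (cell M i \<inter> cell M j) = 0) \<and>
     (\<forall>i. \<forall>F\<in>hyperfaces M i. F \<noteq> {} \<and> F \<subseteq> cell M i)"

definition Vol :: "('x, 'n::finite) mesh \<Rightarrow> 'n \<Rightarrow> real" where
  "Vol M i = measure (volume_measure M) (cell M i)"

definition Omega :: "('x, 'n::finite) mesh \<Rightarrow> real^'n^'n" where
  "Omega M = (\<chi> i j. if i = j then Vol M i else 0)"

definition nbrs :: "('x, 'n::finite) mesh \<Rightarrow> 'n \<Rightarrow> 'n set" where
  "nbrs M i = insert i {j. hyperfaces M i \<inter> hyperfaces M j \<noteq> {}}"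

section \<open>Discrete diffeomorphisms, constraints and the action on densities\<close>

definition commutator :: "real^'n^'n \<Rightarrow> real^'n^'n \<Rightarrow> real^'n^'n" where
  "commutator X Y = X ** Y - Y ** X"

text \<open>In \<open>q *v 1\<close> the \<open>1\<close> is the all-ones vector of type \<open>real^'n\<close>.\<close>

definition discrete_diffeos :: "(real^'n^'n) set" where
  "discrete_diffeos = {q. det q > 0 \<and> q *v 1 = 1}"

definition discrete_fields :: "(real^'n^'n) set" where
  "discrete_fields = {A. A *v 1 = 0}"

definition constraint_S :: "('x, 'n::finite) mesh \<Rightarrow> (real^'n^'n) set" where
  "constraint_S M = {A \<in> discrete_fields. \<forall>i j. j \<notin> nbrs M i \<longrightarrow> A $ i $ j = 0}"

definition is_diagonal :: "real^'n^'n \<Rightarrow> bool" where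
  "is_diagonal A \<longleftrightarrow> (\<forall>i j. i \<noteq> j \<longrightarrow> A $ i $ j = 0)"

definition constraint_R :: "('x, 'n::finite) mesh \<Rightarrow> (real^'n^'n) set" where
  "constraint_R M =
     {A \<in> discrete_fields. is_diagonal (transpose A ** Omega M + Omega M ** A)}"

definition dens_act :: "('x, 'n::finite) mesh \<Rightarrow> real^'n \<Rightarrow> real^'n^'n \<Rightarrow> real^'n" where
  "dens_act M D q = (matrix_inv (Omega M) ** transpose q ** Omega M) *v D"

section \<open>Pairings and functional derivatives\<close>

definition pairing0 :: "('x, 'n::finite) mesh \<Rightarrow> real^'n \<Rightarrow> real^'n \<Rightarrow> real" where
  "pairing0 M F G = F \<bullet> (Omega M *v G)"

definition pairing :: "('x, 'n::finite) mesh \<Rightarrow> real^'n^'n \<Rightarrow> real^'n^'n \<Rightarrow> real" where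
  "pairing M L A = trace (transpose L ** Omega M ** A)"

definition zero_diag :: "(real^'n^'n) set" where
  "zero_diag = {L. \<forall>i. L $ i $ i = 0}"

text \<open>
  The Lagrangian \<open>l\<close> is a total function on matrices and vectors, but only its values on
  \<open>discrete_fields \<times> UNIV\<close> are ever used (for \<open>A \<in> discrete_fields\<close>). The dual of \<open>discrete_fields\<close>
  is represented by \<open>zero_diag\<close>.
\<close>

definition fderiv_A ::
  "('x, 'n::finite) mesh \<Rightarrow> (real^'n^'n \<Rightarrow> real^'n \<Rightarrow> real) \<Rightarrow> real^'n^'n \<Rightarrow> real^'n \<Rightarrow> real^'n^'n" where
  "fderiv_A M l A D =
     (THE L. L \<in> zero_diag \<and>
        (\<forall>\<delta>A\<in>discrete_fields.
           ((\<lambda>\<epsilon>. l (A + \<epsilon> *\<^sub>R \<delta>A) D) has_real_derivative pairing M L \<delta>A) (at 0)))"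

definition fderiv_D ::
  "('x, 'n::finite) mesh \<Rightarrow> (real^'n^'n \<Rightarrow> real^'n \<Rightarrow> real) \<Rightarrow> real^'n^'n \<Rightarrow> real^'n \<Rightarrow> real^'n" where
  "fderiv_D M l A D =
     (THE F. \<forall>\<delta>D.
        ((\<lambda>\<epsilon>. l A (D + \<epsilon> *\<^sub>R \<delta>D)) has_real_derivative pairing0 M F \<delta>D) (at 0))"

section \<open>The projection onto discrete one-forms\<close>

definition diag_hat :: "real^'n^'n \<Rightarrow> real^'n^'n" where
  "diag_hat L = (\<chi> i j. L $ i $ i)"

definition skew_part :: "real^'n^'n \<Rightarrow> real^'n^'n" where
  "skew_part L = (1 / 2) *\<^sub>R (L - transpose L)"

definition one_form_proj :: "real^'n^'n \<Rightarrow> real^'n^'n" where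
  "one_form_proj L = skew_part (L - diag_hat L)"

definition outer :: "real^'n \<Rightarrow> real^'n \<Rightarrow> real^'n^'n" where
  "outer D F = (\<chi> i j. D $ i * F $ j)"

section \<open>The variational principle\<close>

text \<open>Derivative of a curve defined on \<open>{0..T}\<close>, one-sided at the end points.\<close>

abbreviation time_deriv :: "real \<Rightarrow> (real \<Rightarrow> 'a::real_normed_vector) \<Rightarrow> real \<Rightarrow> 'a" where
  "time_deriv T c t \<equiv> vector_derivative c (at t within {0..T})"

definition EPdA_critical ::
  "('x, 'n::finite) mesh \<Rightarrow> (real^'n^'n \<Rightarrow> real^'n \<Rightarrow> real) \<Rightarrow> real \<Rightarrow>
     (real \<Rightarrow> real^'n^'n) \<Rightarrow> (real \<Rightarrow> real^'n) \<Rightarrow> bool" where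
  "EPdA_critical M l T A D \<longleftrightarrow>
     (\<forall>B. smooth_on {0..T} B \<and>
          (\<forall>t\<in>{0..T}. B t \<in> constraint_S M \<inter> constraint_R M) \<and>
          B 0 = 0 \<and> B T = 0 \<longrightarrow>
          integral {0..T} (\<lambda>t.
              pairing M (fderiv_A M l (A t) (D t)) (time_deriv T B t + commutator (B t) (A t)) +
              pairing0 M (fderiv_D M l (A t) (D t))
                (- ((matrix_inv (Omega M) ** transpose (B t) ** Omega M) *v D t))) = 0)"

end

theory Submission
  imports Defs
begin

text \<open>
  Write \<open>L\<close> and \<open>F\<close> for the functional derivatives of \<open>l\<close> along the curve. The pairing is the
  Euclidean inner product of matrices weighted by the cell volumes, and the transpose of
  \<open>B \<mapsto> [B, A]\<close> for it is \<open>L \<mapsto> - Omega\<inverse> [A\<^sup>T, Omega L]\<close>, while the density term of the variation is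
  minus the pairing of \<open>outer D F\<close> with \<open>B\<close> (\<open>pairing_adjoint\<close>). Integrating \<open>L\<close> against the time
  derivative of \<open>B\<close> by parts, which leaves no boundary terms since \<open>B\<close> vanishes at \<open>0\<close> and \<open>T\<close>, turns
  the first variation into minus the integral of the pairing of \<open>E\<close> with \<open>B\<close>, where \<open>E\<close> is the
  matrix to which the projection is applied in the equation of motion (\<open>first_variation_by_parts\<close>).

  It remains to see what being orthogonal to all admissible \<open>B\<close> means. For \<open>B\<close> in \<open>constraint_R\<close> the
  off-diagonal part of \<open>Omega B\<close> is skew, and its diagonal is minus the row sums of that part; so the
  pairing sees only the skew part of \<open>K - diag_hat K\<close>, that is \<open>one_form_proj K\<close>
  (\<open>pairing_one_form_proj\<close>). If this one-form vanishes on neighbouring cells, the pairing with every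
  admissible \<open>B\<close> vanishes. Conversely the elementary flow between two neighbouring cells \<open>i\<close>
  and \<open>j\<close> is admissible and reads off twice the entry \<open>(i, j)\<close> of the one-form
  (\<open>pairing_exchange\<close>). Multiplying it by a scalar function of time that vanishes at the end points
  reduces the claim to the fundamental lemma of the calculus of variations, for which polynomial test
  functions suffice by the Weierstrass theorem (\<open>fundamental_lemma_polynomial\<close>).

  The analytic input is that \<open>L\<close> is continuously differentiable and \<open>F\<close> continuous in time. Both are
  given by partial derivatives of \<open>l\<close> in fixed directions (\<open>fderiv_A_eq\<close>, \<open>fderiv_D_eq\<close>), so this is
  the chain rule along the curve.

  The continuity equation is the time derivative of \<open>q\<^sup>T Omega D = Omega D0\<close>.
\<close>

section \<open>Matrix algebra over the volume form\<close>

lemma matrix_inv_works: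
  fixes A :: "real^'n^'n"
  assumes "invertible A"
  shows "A ** matrix_inv A = mat 1" "matrix_inv A ** A = mat 1"
  using assms unfolding invertible_def matrix_inv_def by (metis (mono_tags, lifting) someI_ex)+

lemma Vol_pos:
  assumes "is_mesh M"
  shows "0 < Vol M i"
  using assms by (simp add: is_mesh_def Vol_def measure_def enn2real_positive_iff)

lemma Omega_mult_component: "(Omega M ** X) $ i $ j = Vol M i * X $ i $ j"
  by (simp add: matrix_matrix_mult_def Omega_def if_distrib[of "\<lambda>x. x * _"] sum.delta cong: if_cong)

lemma mult_Omega_component: "(X ** Omega M) $ i $ j = X $ i $ j * Vol M j"
  by (simp add: matrix_matrix_mult_def Omega_def if_distrib[of "\<lambda>x. _ * x"] sum.delta' cong: if_cong)

lemma Omega_vec_component: "(Omega M *v x) $ i = Vol M i * x $ i"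
  by (simp add: matrix_vector_mult_def Omega_def if_distrib[of "\<lambda>x. x * _"] sum.delta cong: if_cong)

lemma invertible_Omega:
  assumes "is_mesh M"
  shows "invertible (Omega M)"
proof -
  define W where "W = (\<chi> i j. if i = j then 1 / Vol M i else 0)"
  have "Omega M ** W = mat 1" "W ** Omega M = mat 1"
    using Vol_pos[OF assms]
    by (auto simp: vec_eq_iff Omega_mult_component mult_Omega_component W_def mat_def less_imp_neq[THEN not_sym])
  then show ?thesis
    unfolding invertible_def by blast
qed

text \<open>
  In this and the next facts boundedness is what makes the product rule and the continuity of
  products of curves available.
\<close>

lemma bounded_bilinear_matrix_mult: "bounded_bilinear ((**) :: real^'n^'n \<Rightarrow> real^'n^'n \<Rightarrow> real^'n^'n)"
  unfolding bilinear_conv_bounded_bilinear[symmetric] bilinear_def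
  by (auto intro!: linearI simp: vec_eq_iff matrix_matrix_mult_def algebra_simps sum.distrib sum_distrib_left)

lemma bounded_bilinear_matrix_vector_mult: "bounded_bilinear ((*v) :: real^'n^'n \<Rightarrow> real^'n \<Rightarrow> real^'n)"
  unfolding bilinear_conv_bounded_bilinear[symmetric] bilinear_def
  by (auto intro!: linearI simp: vec_eq_iff matrix_vector_mult_def algebra_simps sum.distrib sum_distrib_left)

lemma bounded_bilinear_outer: "bounded_bilinear (outer :: real^'n \<Rightarrow> real^'n \<Rightarrow> real^'n^'n)"
  unfolding bilinear_conv_bounded_bilinear[symmetric] bilinear_def
  by (auto intro!: linearI simp: vec_eq_iff outer_def algebra_simps)

lemma bounded_linear_transpose: "bounded_linear (transpose :: real^'n^'n \<Rightarrow> real^'n^'n)"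
  by (auto intro!: linear_conv_bounded_linear[THEN iffD1] linearI simp: vec_eq_iff transpose_def)

lemma pairing_eq_sum:
  fixes M :: "('x, 'n::finite) mesh"
  shows "pairing M L X = (\<Sum>i\<in>UNIV. \<Sum>j\<in>UNIV. Vol M i * L $ i $ j * X $ i $ j)"
proof -
  have "(transpose L ** Y) $ j $ j = (\<Sum>i\<in>UNIV. L $ i $ j * Y $ i $ j)" for Y :: "real^'n^'n" and j
    by (simp add: matrix_matrix_mult_def transpose_def)
  then have "pairing M L X = (\<Sum>j\<in>UNIV. \<Sum>i\<in>UNIV. L $ i $ j * (Omega M ** X) $ i $ j)"
    by (simp add: pairing_def trace_def matrix_mul_assoc[symmetric])
  also have "\<dots> = (\<Sum>j\<in>UNIV. \<Sum>i\<in>UNIV. Vol M i * L $ i $ j * X $ i $ j)"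
    by (simp add: Omega_mult_component ac_simps)
  finally show ?thesis
    by (subst sum.swap)
qed

lemma pairing_add_left: "pairing M (K + L) X = pairing M K X + pairing M L X"
  and pairing_diff_left: "pairing M (K - L) X = pairing M K X - pairing M L X"
  and pairing_scaleR_left: "pairing M (c *\<^sub>R L) X = c * pairing M L X"
  and pairing_add_right: "pairing M L (X + Y) = pairing M L X + pairing M L Y"
  and pairing_diff_right: "pairing M L (X - Y) = pairing M L X - pairing M L Y"
  and pairing_scaleR_right: "pairing M L (c *\<^sub>R X) = c * pairing M L X"
  by (simp_all add: pairing_eq_sum algebra_simps sum.distrib sum_subtractf sum_distrib_left)

lemma bounded_bilinear_pairing: "bounded_bilinear (pairing M :: real^'n^'n \<Rightarrow> real^'n^'n \<Rightarrow> real)"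
  unfolding bilinear_conv_bounded_bilinear[symmetric] bilinear_def
  by (auto intro!: linearI simp: pairing_add_left pairing_add_right pairing_scaleR_left pairing_scaleR_right)

lemma pairing0_eq_sum: "pairing0 M F G = (\<Sum>i\<in>UNIV. Vol M i * F $ i * G $ i)"
  by (simp add: pairing0_def inner_vec_def Omega_vec_component ac_simps)

section \<open>One-forms and admissible fields\<close>

lemma discrete_fields_iff: "X \<in> discrete_fields \<longleftrightarrow> (\<forall>i. (\<Sum>j\<in>UNIV. X $ i $ j) = 0)"
  by (simp add: discrete_fields_def vec_eq_iff matrix_vector_mult_def)

lemma subspace_discrete_fields: "subspace (discrete_fields :: (real^'n^'n) set)"
  unfolding subspace_def
  by (auto simp: discrete_fields_iff sum.distrib sum_distrib_left[symmetric])

lemma constraint_R_skew: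
  assumes "B \<in> constraint_R M" "i \<noteq> j"
  shows "Vol M j * B $ j $ i = - (Vol M i * B $ i $ j)"
proof -
  have "(transpose B ** Omega M + Omega M ** B) $ i $ j = 0"
    using assms by (auto simp: constraint_R_def is_diagonal_def)
  then show ?thesis
    by (simp add: mult_Omega_component Omega_mult_component transpose_def algebra_simps)
qed

text \<open>
  Zero row sums make the pairing blind to \<open>diag_hat K\<close>. What is left of \<open>K\<close> has zero diagonal and is
  therefore paired with the off-diagonal part of \<open>Omega B\<close> only. That part is skew, so it ignores
  the symmetric part of its partner.
\<close>

lemma pairing_one_form_proj:
  assumes B: "B \<in> constraint_R M"
  shows "pairing M (one_form_proj K) B = pairing M K B"
proof -
  define Z where "Z = K - diag_hat K"
  have Zii: "Z $ i $ i = 0" for i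
    by (simp add: Z_def diag_hat_def)
  have "pairing M (diag_hat K) B = (\<Sum>i\<in>UNIV. Vol M i * K $ i $ i * (\<Sum>j\<in>UNIV. B $ i $ j))"
    by (simp add: pairing_eq_sum diag_hat_def sum_distrib_left)
  also have "\<dots> = 0"
    using B by (simp add: constraint_R_def discrete_fields_iff)
  finally have hat: "pairing M Z B = pairing M K B"
    by (simp add: Z_def pairing_diff_left)
  have "pairing M (transpose Z) B = (\<Sum>i\<in>UNIV. \<Sum>j\<in>UNIV. - (Vol M j * Z $ j $ i * B $ j $ i))"
    unfolding pairing_eq_sum
  proof (intro sum.cong refl)
    fix i j
    show "Vol M i * transpose Z $ i $ j * B $ i $ j = - (Vol M j * Z $ j $ i * B $ j $ i)"
    proof (cases "i = j")
      case False
      have "Vol M i * Z $ j $ i * B $ i $ j = Z $ j $ i * (Vol M i * B $ i $ j)"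
        by simp
      also have "Vol M i * B $ i $ j = - (Vol M j * B $ j $ i)"
        using constraint_R_skew[OF B False] by simp
      finally show ?thesis
        by (simp add: transpose_def)
    qed (simp add: transpose_def Zii)
  qed
  also have "\<dots> = - pairing M Z B"
    unfolding pairing_eq_sum by (subst sum.swap) (simp add: sum_negf)
  finally show ?thesis
    using hat by (simp add: one_form_proj_def skew_part_def Z_def[symmetric] pairing_scaleR_left pairing_diff_left)
qed

text \<open>
  The generator of a Markov jump from cell \<open>i\<close> to cell \<open>j\<close> with rate one: the matrix unit at
  \<open>(i, j)\<close> minus the one at \<open>(i, i)\<close>, hence zero when \<open>i = j\<close>. For \<open>i \<noteq> j\<close> these matrices form a
  basis of the fields with zero row sums.
\<close>

definition jump :: "'n \<Rightarrow> 'n \<Rightarrow> real^'n^'n" where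
  "jump i j = axis i (axis j 1 - axis i 1)"

lemma jump_component: "jump i j $ a $ b = (if a = i then (if b = j then 1 else 0) - (if b = i then 1 else 0) else 0)"
  by (auto simp: jump_def axis_def)

lemma jump_in_discrete_fields: "jump i j \<in> discrete_fields"
proof -
  have "(\<Sum>b\<in>UNIV. jump i j $ a $ b) = 0" for a
    by (cases "a = i") (simp_all add: jump_component sum_subtractf)
  then show ?thesis
    by (simp add: discrete_fields_iff)
qed

text \<open>
  The coefficients include the diagonal ones, whose basis matrix is zero; the diagonal of \<open>X\<close> comes
  out right because the rows of \<open>X\<close> sum to zero.
\<close>

lemma discrete_field_expansion:
  assumes "X \<in> discrete_fields"
  shows "X = (\<Sum>i\<in>UNIV. \<Sum>j\<in>UNIV. X $ i $ j *\<^sub>R jump i j)"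
proof -
  have "(\<Sum>i\<in>UNIV. \<Sum>j\<in>UNIV. X $ i $ j *\<^sub>R jump i j) $ a $ b = X $ a $ b" for a b
  proof -
    have "(\<Sum>i\<in>UNIV. \<Sum>j\<in>UNIV. X $ i $ j *\<^sub>R jump i j) $ a $ b
        = (\<Sum>i\<in>UNIV. if a = i then \<Sum>j\<in>UNIV. X $ i $ j * ((if b = j then 1 else 0) - (if b = i then 1 else 0)) else 0)"
      unfolding sum_component vector_scaleR_component
    proof (intro sum.cong refl)
      fix i
      show "(\<Sum>j\<in>UNIV. X $ i $ j *\<^sub>R jump i j $ a $ b) = 
        (if a = i then \<Sum>j\<in>UNIV. X $ i $ j * ((if b = j then 1 else 0) - (if b = i then 1 else 0)) else 0)"
        by (cases "a = i") (simp_all add: jump_component)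
    qed
    also have "\<dots> = (\<Sum>j\<in>UNIV. X $ a $ j * ((if b = j then 1 else 0) - (if b = a then 1 else 0)))"
      by simp
    also have "\<dots> = (\<Sum>j\<in>UNIV. if b = j then X $ a $ j else 0) - (if b = a then 1 else 0) * (\<Sum>j\<in>UNIV. X $ a $ j)"
      unfolding sum_distrib_left sum_subtractf[symmetric] by (intro sum.cong) auto
    also have "\<dots> = X $ a $ b"
      using assms by (simp add: discrete_fields_iff)
    finally show ?thesis .
  qed
  then show ?thesis
    by (simp add: vec_eq_iff)
qed

lemma pairing_jump: "pairing M K (jump i j) = Vol M i * (K $ i $ j - K $ i $ i)"
proof -
  have "pairing M K (jump i j) = (\<Sum>a\<in>UNIV. if a = i then 
     (\<Sum>b\<in>UNIV. (if b = j then Vol M a * K $ a $ b else 0) - (if b = i then Vol M a * K $ a $ b else 0)) else 0)"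
    unfolding pairing_eq_sum by (intro sum.cong) (auto simp: jump_component intro!: sum.cong)
  then show ?thesis
    by (simp add: sum_subtractf algebra_simps)
qed

lemma nbrs_sym: "i \<in> nbrs M j \<longleftrightarrow> j \<in> nbrs M i"
  by (auto simp: nbrs_def)

text \<open>
  The elementary flow through the interface of \<open>i\<close> and \<open>j\<close>. The volumes are divided out so that, off
  the diagonal, \<open>Omega\<close> times this field is the matrix unit at \<open>(i, j)\<close> minus the one at \<open>(j, i)\<close>;
  this skewness is the constraint \<open>constraint_R\<close>.
\<close>

definition exchange :: "('x, 'n::finite) mesh \<Rightarrow> 'n \<Rightarrow> 'n \<Rightarrow> real^'n^'n" where
  "exchange M i j = (1 / Vol M i) *\<^sub>R jump i j - (1 / Vol M j) *\<^sub>R jump j i"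

lemma exchange_admissible:
  assumes M: "is_mesh M" and ij: "i \<in> nbrs M j"
  shows "exchange M i j \<in> constraint_S M \<inter> constraint_R M"
proof -
  have V: "Vol M k \<noteq> 0" for k
    using Vol_pos[OF M, of k] by simp
  have fld: "exchange M i j \<in> discrete_fields"
    unfolding exchange_def
    by (intro subspace_diff subspace_scale subspace_discrete_fields jump_in_discrete_fields)
  have "j \<in> nbrs M i"
    using ij nbrs_sym by metis
  then have "exchange M i j $ a $ b = 0" if "b \<notin> nbrs M a" for a b
    using that ij by (auto simp: exchange_def jump_component nbrs_def)
  moreover have "is_diagonal (transpose (exchange M i j) ** Omega M + Omega M ** exchange M i j)"
    using V by (auto simp: is_diagonal_def mult_Omega_component Omega_mult_component transpose_def
        exchange_def jump_component)
  ultimately show ?thesis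
    using fld by (auto simp: constraint_S_def constraint_R_def)
qed

lemma pairing_exchange:
  assumes "is_mesh M"
  shows "pairing M K (exchange M i j) = 2 * one_form_proj K $ i $ j"
  using Vol_pos[OF assms, of i] Vol_pos[OF assms, of j]
  by (simp add: exchange_def pairing_diff_right pairing_scaleR_right pairing_jump one_form_proj_def
      skew_part_def diag_hat_def transpose_def)

lemma admissible_scaleR:
  assumes "B \<in> constraint_S M \<inter> constraint_R M"
  shows "c *\<^sub>R B \<in> constraint_S M \<inter> constraint_R M"
proof -
  have "transpose (c *\<^sub>R B) ** Omega M + Omega M ** (c *\<^sub>R B) = c *\<^sub>R (transpose B ** Omega M + Omega M ** B)"
    by (simp add: vec_eq_iff mult_Omega_component Omega_mult_component transpose_def algebra_simps)
  moreover have "is_diagonal (transpose B ** Omega M + Omega M ** B)"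
    using assms by (simp add: constraint_R_def)
  ultimately have "is_diagonal (transpose (c *\<^sub>R B) ** Omega M + Omega M ** (c *\<^sub>R B))"
    by (simp only: is_diagonal_def vector_scaleR_component) simp
  with assms show ?thesis
    by (simp add: constraint_S_def constraint_R_def subspace_scale[OF subspace_discrete_fields])
qed

text \<open>
  Both terms of the first variation without time derivative are linear in \<open>B\<close>. This moves \<open>B\<close> to the
  right slot of the pairing by cyclicity of the trace, \<open>tr (Y\<^sup>T B A) = tr (A Y\<^sup>T B)\<close> with \<open>Y = Omega L\<close>.
\<close>

lemma pairing_adjoint:
  assumes M: "is_mesh M"
  shows "pairing M L (commutator B A) + pairing0 M F (- ((matrix_inv (Omega M) ** transpose B ** Omega M) *v D))
     = - pairing M (matrix_inv (Omega M) ** commutator (transpose A) (Omega M ** L) + outer D F) B"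
proof -
  let ?W = "matrix_inv (Omega M)"
  let ?tr = "\<lambda>X Y. trace (transpose X ** Y)"
  have p: "pairing M X Y = trace (transpose (Omega M ** X) ** Y)" for X Y
  proof -
    have "transpose (Omega M) = Omega M"
      by (simp add: vec_eq_iff transpose_def Omega_def)
    then show ?thesis
      by (simp add: pairing_def matrix_transpose_mul)
  qed
  have WO: "Omega M ** (?W ** X) = X" for X
    by (simp add: matrix_mul_assoc matrix_inv_works(1)[OF invertible_Omega[OF M]])
  define Y where "Y = Omega M ** L"
  have "pairing M (?W ** commutator (transpose A) Y) B = ?tr (commutator (transpose A) Y) B"
    by (simp add: p WO)
  also have "\<dots> = trace (transpose Y ** (A ** B)) - trace (A ** (transpose Y ** B))"
  proof -
    have "transpose (commutator (transpose A) Y) = transpose Y ** A - A ** transpose Y"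
      by (simp add: commutator_def vec_eq_iff transpose_def matrix_matrix_mult_def ac_simps)
    then show ?thesis
      by (simp add: bounded_bilinear.diff_left[OF bounded_bilinear_matrix_mult] trace_sub matrix_mul_assoc)
  qed
  also have "trace (A ** (transpose Y ** B)) = trace (transpose Y ** (B ** A))"
    by (subst trace_mul_sym) (simp add: matrix_mul_assoc)
  also have "trace (transpose Y ** (A ** B)) - trace (transpose Y ** (B ** A)) = - pairing M L (commutator B A)"
    by (simp add: p Y_def[symmetric] commutator_def bounded_bilinear.diff_right[OF bounded_bilinear_matrix_mult] trace_sub)
  finally have 1: "pairing M (?W ** commutator (transpose A) (Omega M ** L)) B = - pairing M L (commutator B A)"
    by (simp add: Y_def)
  have "pairing0 M F ((?W ** transpose B ** Omega M) *v D)
      = (\<Sum>j\<in>UNIV. F $ j * (Omega M *v ((?W ** transpose B ** Omega M) *v D)) $ j)"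
    by (simp add: pairing0_def inner_vec_def)
  also have "Omega M *v ((?W ** transpose B ** Omega M) *v D) = transpose B *v (Omega M *v D)"
    by (simp add: matrix_vector_mul_assoc matrix_mul_assoc matrix_inv_works(1)[OF invertible_Omega[OF M]])
  also have "(\<Sum>j\<in>UNIV. F $ j * (transpose B *v (Omega M *v D)) $ j)
      = (\<Sum>j\<in>UNIV. \<Sum>i\<in>UNIV. Vol M i * (D $ i * F $ j) * B $ i $ j)"
  proof -
    have "(transpose B *v y) $ j = (\<Sum>i\<in>UNIV. B $ i $ j * y $ i)" for y j
      by (simp add: matrix_vector_mult_def transpose_def)
    then show ?thesis
      by (simp add: Omega_vec_component sum_distrib_left ac_simps)
  qed
  also have "\<dots> = pairing M (outer D F) B"
    unfolding pairing_eq_sum by (subst sum.swap) (simp add: outer_def)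
  finally have "pairing0 M F ((?W ** transpose B ** Omega M) *v D) = pairing M (outer D F) B" .
  moreover have "pairing0 M F (- x) = - pairing0 M F x" for x
    by (simp add: pairing0_eq_sum sum_negf)
  ultimately show ?thesis
    using 1 by (simp add: pairing_add_left)
qed

section \<open>Functional derivatives\<close>

lemma has_derivative_along_line:
  fixes f :: "'a::real_normed_vector \<Rightarrow> real"
  assumes f: "(f has_derivative f') (at x within S)" and S: "\<And>\<epsilon>. x + \<epsilon> *\<^sub>R v \<in> S"
  shows "((\<lambda>\<epsilon>. f (x + \<epsilon> *\<^sub>R v)) has_real_derivative f' v) (at 0)"
proof -
  have "((\<lambda>\<epsilon>. x + \<epsilon> *\<^sub>R v) has_derivative (\<lambda>\<epsilon>. \<epsilon> *\<^sub>R v)) (at 0)"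
    by (auto intro!: derivative_eq_intros)
  moreover have "(f has_derivative f') (at (x + 0 *\<^sub>R v) within range (\<lambda>\<epsilon>. x + \<epsilon> *\<^sub>R v))"
    using S by (auto intro: has_derivative_subset[OF f])
  ultimately have "((\<lambda>\<epsilon>. f (x + \<epsilon> *\<^sub>R v)) has_derivative (\<lambda>\<epsilon>. f' (\<epsilon> *\<^sub>R v))) (at 0)"
    by (rule has_derivative_in_compose)
  moreover have "f' (\<epsilon> *\<^sub>R v) = f' v * \<epsilon>" for \<epsilon>
    using linear_cmul[OF has_derivative_linear[OF f]] by simp
  ultimately show ?thesis
    by (simp add: has_field_derivative_def)
qed

text \<open>
  Identifies the unique zero-diagonal representative explicitly. A zero-diagonal \<open>L\<close> paired with
  \<open>jump i j\<close> gives \<open>Vol i\<close> times its entry at \<open>(i, j)\<close>, so the entries must be partial derivatives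
  in the jump directions; these are enough because the jumps span \<open>discrete_fields\<close>. The formula has
  zero diagonal by itself, as \<open>jump i i = 0\<close>.
\<close>

lemma fderiv_A_eq:
  fixes l :: "real^'n^'n \<Rightarrow> real^'n \<Rightarrow> real"
  assumes M: "is_mesh M" and X: "X \<in> discrete_fields"
    and l': "((\<lambda>(X, Y). l X Y) has_derivative l') (at (X, Y) within discrete_fields \<times> UNIV)"
  shows "fderiv_A M l X Y = (\<chi> i j. l' (jump i j, 0) / Vol M i)"
  unfolding fderiv_A_def
proof (rule the_equality)
  have lin: "linear (\<lambda>Z. l' (Z, 0))"
    using linear_compose[OF _ has_derivative_linear[OF l'], of "\<lambda>Z. (Z, 0)"]
    by (simp add: linear_iff o_def)
  have V: "Vol M i \<noteq> 0" for i
    using Vol_pos[OF M, of i] by simp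
  have der: "((\<lambda>\<epsilon>. l (X + \<epsilon> *\<^sub>R Z) Y) has_real_derivative l' (Z, 0)) (at 0)" if "Z \<in> discrete_fields" for Z
    using has_derivative_along_line[OF l', of "(Z, 0)"] X that
    by (simp add: subspace_add[OF subspace_discrete_fields] subspace_scale[OF subspace_discrete_fields])
  let ?L = "\<chi> i j. l' (jump i j, 0) / Vol M i"
  have "pairing M ?L Z = l' (Z, 0)" if "Z \<in> discrete_fields" for Z
  proof -
    have "l' (Z, 0) = l' (\<Sum>i\<in>UNIV. \<Sum>j\<in>UNIV. Z $ i $ j *\<^sub>R jump i j, 0)"
      using discrete_field_expansion[OF that] by simp
    also have "\<dots> = (\<Sum>i\<in>UNIV. \<Sum>j\<in>UNIV. Z $ i $ j * l' (jump i j, 0))"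
      by (simp add: linear_sum[OF lin] linear_cmul[OF lin])
    also have "\<dots> = pairing M ?L Z"
      using V by (simp add: pairing_eq_sum ac_simps)
    finally show ?thesis by simp
  qed
  moreover have "jump i i = 0" for i :: 'n
    by (simp add: jump_def)
  ultimately show "?L \<in> zero_diag \<and>
      (\<forall>Z\<in>discrete_fields. ((\<lambda>\<epsilon>. l (X + \<epsilon> *\<^sub>R Z) Y) has_real_derivative pairing M ?L Z) (at 0))"
    using der linear_0[OF lin] by (simp add: zero_diag_def)
  fix L
  assume L: "L \<in> zero_diag \<and>
      (\<forall>Z\<in>discrete_fields. ((\<lambda>\<epsilon>. l (X + \<epsilon> *\<^sub>R Z) Y) has_real_derivative pairing M L Z) (at 0))"
  have "L $ i $ j = l' (jump i j, 0) / Vol M i" for i j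
  proof -
    have "pairing M L (jump i j) = l' (jump i j, 0)"
      using L der jump_in_discrete_fields DERIV_unique by blast
    with L V show ?thesis
      by (simp add: pairing_jump zero_diag_def field_simps)
  qed
  then show "L = ?L"
    by (simp add: vec_eq_iff)
qed

lemma fderiv_D_eq:
  fixes l :: "real^'n^'n \<Rightarrow> real^'n \<Rightarrow> real"
  assumes M: "is_mesh M" and X: "X \<in> discrete_fields"
    and l': "((\<lambda>(X, Y). l X Y) has_derivative l') (at (X, Y) within discrete_fields \<times> UNIV)"
  shows "fderiv_D M l X Y = (\<chi> i. l' (0, axis i 1) / Vol M i)"
  unfolding fderiv_D_def
proof (rule the_equality)
  have lin: "linear (\<lambda>Z. l' (0, Z))"
    using linear_compose[OF _ has_derivative_linear[OF l'], of "\<lambda>Z. (0, Z)"]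
    by (simp add: linear_iff o_def)
  have V: "Vol M i \<noteq> 0" for i
    using Vol_pos[OF M, of i] by simp
  have der: "((\<lambda>\<epsilon>. l X (Y + \<epsilon> *\<^sub>R Z)) has_real_derivative l' (0, Z)) (at 0)" for Z
    using has_derivative_along_line[OF l', of "(0, Z)"] X by simp
  let ?F = "\<chi> i. l' (0, axis i 1) / Vol M i"
  have "pairing0 M ?F Z = l' (0, Z)" for Z
  proof -
    have "l' (0, Z) = l' (0, \<Sum>i\<in>UNIV. Z $ i *\<^sub>R axis i 1)"
      using basis_expansion[of Z] by (simp add: scalar_mult_eq_scaleR)
    also have "\<dots> = (\<Sum>i\<in>UNIV. Z $ i * l' (0, axis i 1))"
      by (simp add: linear_sum[OF lin] linear_cmul[OF lin])
    also have "\<dots> = pairing0 M ?F Z"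
      using V by (simp add: pairing0_eq_sum ac_simps)
    finally show ?thesis by simp
  qed
  then show "\<forall>Z. ((\<lambda>\<epsilon>. l X (Y + \<epsilon> *\<^sub>R Z)) has_real_derivative pairing0 M ?F Z) (at 0)"
    using der by simp
  fix F
  assume F: "\<forall>Z. ((\<lambda>\<epsilon>. l X (Y + \<epsilon> *\<^sub>R Z)) has_real_derivative pairing0 M F Z) (at 0)"
  have "F $ i = l' (0, axis i 1) / Vol M i" for i
  proof -
    have "pairing0 M F (axis i 1) = l' (0, axis i 1)"
      using F der DERIV_unique by blast
    moreover have "pairing0 M F (axis i 1) = Vol M i * F $ i"
      by (simp add: pairing0_eq_sum axis_def if_distrib[of "\<lambda>x. _ * x"] cong: if_cong)
    ultimately show ?thesis
      using V by (simp add: field_simps)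
  qed
  then show "F = ?F"
    by (simp add: vec_eq_iff)
qed

section \<open>Differentiability along curves\<close>

lemma Ck_on_cong:
  assumes "Ck_on k S f" "\<And>x. x \<in> S \<Longrightarrow> f x = g x"
  shows "Ck_on k S g"
proof (cases k)
  case 0
  with assms show ?thesis
    using continuous_on_cong by force
next
  case (Suc m)
  with assms(1) obtain f' where "\<forall>x\<in>S. (f has_derivative f' x) (at x within S)" "\<forall>v. Ck_on m S (\<lambda>x. f' x v)"
    by auto
  moreover from this(1) have "\<forall>x\<in>S. (g has_derivative f' x) (at x within S)"
    by (metis assms(2) has_derivative_transform)
  ultimately show ?thesis
    unfolding Suc Ck_on.simps by blast
qed

lemma Ck_on_imp_continuous_on:
  assumes "Ck_on k S f"
  shows "continuous_on S f"
proof (cases k)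
  case 0
  with assms show ?thesis by simp
next
  case (Suc m)
  with assms show ?thesis
    by (auto intro: has_derivative_continuous_on)
qed

lemma Ck_on_Pair:
  assumes "Ck_on k S f" "Ck_on k S g"
  shows "Ck_on k S (\<lambda>x. (f x, g x))"
  using assms
proof (induction k arbitrary: f g)
  case 0
  then show ?case by (simp add: continuous_on_Pair)
next
  case (Suc k)
  obtain f' where f': "\<forall>x\<in>S. (f has_derivative f' x) (at x within S)" "\<forall>v. Ck_on k S (\<lambda>x. f' x v)"
    using Suc.prems by auto
  obtain g' where g': "\<forall>x\<in>S. (g has_derivative g' x) (at x within S)" "\<forall>v. Ck_on k S (\<lambda>x. g' x v)"
    using Suc.prems by auto
  show ?case
    using f' g' Suc.IH by (auto intro!: exI[of _ "\<lambda>x v. (f' x v, g' x v)"] has_derivative_Pair)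
qed

lemma Ck_on_add:
  assumes "Ck_on k S f" "Ck_on k S g"
  shows "Ck_on k S (\<lambda>x. f x + g x)"
  using assms
proof (induction k arbitrary: f g)
  case 0
  then show ?case by (simp add: continuous_on_add)
next
  case (Suc k)
  obtain f' where f': "\<forall>x\<in>S. (f has_derivative f' x) (at x within S)" "\<forall>v. Ck_on k S (\<lambda>x. f' x v)"
    using Suc.prems by auto
  obtain g' where g': "\<forall>x\<in>S. (g has_derivative g' x) (at x within S)" "\<forall>v. Ck_on k S (\<lambda>x. g' x v)"
    using Suc.prems by auto
  show ?case
    using f' g' Suc.IH by (auto intro!: exI[of _ "\<lambda>x v. f' x v + g' x v"] has_derivative_add)
qed

lemma Ck_on_zero: "Ck_on k S (\<lambda>x. 0)"
  by (induction k) (auto intro!: exI[of _ "\<lambda>x v. 0"])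

lemma Ck_on_sum:
  assumes "finite I" "\<And>i. i \<in> I \<Longrightarrow> Ck_on k S (f i)"
  shows "Ck_on k S (\<lambda>x. \<Sum>i\<in>I. f i x)"
  using assms by (induction I rule: finite_induct) (auto intro: Ck_on_add Ck_on_zero)

lemma Ck_on_scaleR_const:
  fixes f :: "'a::euclidean_space \<Rightarrow> real"
  assumes "Ck_on k S f"
  shows "Ck_on k S (\<lambda>x. f x *\<^sub>R v)"
  using assms
proof (induction k arbitrary: f)
  case 0
  then show ?case by (auto intro!: continuous_intros)
next
  case (Suc k)
  obtain f' where f': "\<forall>x\<in>S. (f has_derivative f' x) (at x within S)" "\<forall>v. Ck_on k S (\<lambda>x. f' x v)"
    using Suc.prems by auto
  show ?case
    using f' Suc.IH by (auto intro!: exI[of _ "\<lambda>x w. f' x w *\<^sub>R v"] has_derivative_scaleR_left)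
qed

lemma Ck_on_matrix:
  fixes f :: "'n::finite \<Rightarrow> 'm::finite \<Rightarrow> 'a::euclidean_space \<Rightarrow> real"
  assumes "\<And>i j. Ck_on k S (f i j)"
  shows "Ck_on k S (\<lambda>x. \<chi> i j. f i j x)"
proof -
  have "(\<chi> i j. f i j x) = (\<Sum>i\<in>UNIV. \<Sum>j\<in>UNIV. f i j x *\<^sub>R axis i (axis j 1))" for x
  proof -
    have "(\<Sum>i\<in>UNIV. \<Sum>j\<in>UNIV. f i j x *\<^sub>R axis i (axis j 1)) $ a $ b = f a b x" for a b
    proof -
      have "(\<Sum>i\<in>UNIV. \<Sum>j\<in>UNIV. f i j x *\<^sub>R axis i (axis j 1)) $ a $ b
          = (\<Sum>i\<in>UNIV. \<Sum>j\<in>UNIV. if i = a then (if j = b then f i j x else 0) else 0)"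
        unfolding sum_component vector_scaleR_component
        by (intro sum.cong refl) (simp add: axis_def)
      also have "\<dots> = (\<Sum>i\<in>UNIV. if i = a then (\<Sum>j\<in>UNIV. if j = b then f i j x else 0) else 0)"
        by (intro sum.cong refl) simp
      also have "\<dots> = f a b x"
        by simp
      finally show ?thesis .
    qed
    then show ?thesis
      by (simp add: vec_eq_iff)
  qed
  then show ?thesis
    using assms by (simp add: Ck_on_sum Ck_on_scaleR_const)
qed

text \<open>
  Continuity of the derivative of \<open>f\<close> is known in each fixed direction only, while the chain rule
  evaluates it in the moving direction given by the derivative of \<open>c\<close>. Expanding that direction in
  the standard basis separates the two.
\<close>

lemma C1_on_compose:
  assumes f: "Ck_on (Suc 0) S f" and c: "Ck_on (Suc 0) R c" and sub: "c ` R \<subseteq> S"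
  shows "Ck_on (Suc 0) R (\<lambda>t. f (c t))"
proof -
  obtain f' where f': "\<And>x. x \<in> S \<Longrightarrow> (f has_derivative f' x) (at x within S)" "\<And>v. continuous_on S (\<lambda>x. f' x v)"
    using f by auto
  obtain c' where c': "\<And>t. t \<in> R \<Longrightarrow> (c has_derivative c' t) (at t within R)" "\<And>v. continuous_on R (\<lambda>t. c' t v)"
    using c by auto
  have cont: "continuous_on R c"
    using c Ck_on_imp_continuous_on by blast
  have "continuous_on R (\<lambda>t. f' (c t) (c' t v))" for v
  proof -
    have "f' (c t) (c' t v) = (\<Sum>b\<in>Basis. (c' t v \<bullet> b) *\<^sub>R f' (c t) b)" if "t \<in> R" for t
    proof -
      have lin: "linear (f' (c t))"
        using f'(1)[of "c t"] sub that has_derivative_linear by blast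
      have "f' (c t) (c' t v) = f' (c t) (\<Sum>b\<in>Basis. (c' t v \<bullet> b) *\<^sub>R b)"
        by (simp add: euclidean_representation)
      then show ?thesis
        by (simp add: linear_sum[OF lin] linear_cmul[OF lin])
    qed
    moreover have "continuous_on R (\<lambda>t. \<Sum>b\<in>Basis. (c' t v \<bullet> b) *\<^sub>R f' (c t) b)"
      using continuous_on_compose2[OF f'(2) cont sub] c'(2)
      by (intro continuous_intros) auto
    ultimately show ?thesis
      by (simp cong: continuous_on_cong)
  qed
  moreover have "((\<lambda>t. f (c t)) has_derivative (\<lambda>v. f' (c t) (c' t v))) (at t within R)" if "t \<in> R" for t
    using has_derivative_in_compose[OF c'(1)[OF that]] has_derivative_subset[OF f'(1) sub] sub that by blast
  ultimately show ?thesis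
    by (auto intro!: exI[of _ "\<lambda>t v. f' (c t) (c' t v)"])
qed

lemma C1_curve_time_deriv:
  fixes c :: "real \<Rightarrow> 'a::euclidean_space"
  assumes c: "Ck_on (Suc 0) {0..T} c" and T: "0 < T"
  shows "\<And>t. t \<in> {0..T} \<Longrightarrow> (c has_vector_derivative time_deriv T c t) (at t within {0..T})"
    and "continuous_on {0..T} (time_deriv T c)"
proof -
  obtain c' where c': "\<And>t. t \<in> {0..T} \<Longrightarrow> (c has_derivative c' t) (at t within {0..T})"
      "\<And>v. continuous_on {0..T} (\<lambda>t. c' t v)"
    using c by (auto simp del: atLeastAtMost_iff)
  have hv: "(c has_vector_derivative c' t 1) (at t within {0..T})" if "t \<in> {0..T}" for t
  proof -
    have "c' t h = h *\<^sub>R c' t 1" for h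
      by (metis c'(1) has_derivative_linear linear_cmul mult.right_neutral real_scaleR_def that)
    then have "c' t = (\<lambda>h. h *\<^sub>R c' t 1)"
      by blast
    with c'(1)[OF that] show ?thesis
      unfolding has_vector_derivative_def by metis
  qed
  then have eq: "time_deriv T c t = c' t 1" if "t \<in> {0..T}" for t
    using vector_derivative_within_closed_interval[OF T that] that by blast
  show "(c has_vector_derivative time_deriv T c t) (at t within {0..T})" if "t \<in> {0..T}" for t
    using hv eq that by simp
  show "continuous_on {0..T} (time_deriv T c)"
    using c'(2)[of 1] eq continuous_on_cong[of "{0..T}" "{0..T}" "time_deriv T c" "\<lambda>t. c' t 1"] by blast
qed

text \<open>
  Two derivatives of \<open>l\<close> are used: one to form the functional derivative and one to differentiate it in
  time.
\<close>

lemma fderivs_along_curve: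
  fixes M :: "('x, 'n::finite) mesh" and A :: "real \<Rightarrow> real^'n^'n"
  assumes M: "is_mesh M" and l: "Ck_on (Suc (Suc 0)) (discrete_fields \<times> UNIV) (\<lambda>(X, Y). l X Y)"
    and A: "Ck_on (Suc 0) R A" "\<And>t. t \<in> R \<Longrightarrow> A t \<in> discrete_fields" and D: "Ck_on (Suc 0) R D"
  shows "Ck_on (Suc 0) R (\<lambda>t. fderiv_A M l (A t) (D t))"
    and "continuous_on R (\<lambda>t. fderiv_D M l (A t) (D t))"
proof -
  let ?S = "discrete_fields \<times> UNIV :: ((real^'n^'n) \<times> (real^'n)) set"
  obtain l' where l': "\<And>z. z \<in> ?S \<Longrightarrow> ((\<lambda>(X, Y). l X Y) has_derivative l' z) (at z within ?S)"
      and l'': "\<And>v. Ck_on (Suc 0) ?S (\<lambda>z. l' z v)"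
    using l unfolding Ck_on.simps(2)[of "Suc 0"] by blast
  have AD: "Ck_on (Suc 0) R (\<lambda>t. (A t, D t))"
    using Ck_on_Pair A D by blast
  have part: "Ck_on (Suc 0) R (\<lambda>t. l' (A t, D t) v)" for v
    by (rule C1_on_compose[OF l'' AD]) (use A(2) in auto)
  have "Ck_on (Suc 0) R (\<lambda>t. l' (A t, D t) v / c)" for v and c :: real
    using Ck_on_scaleR_const[OF part[of v], of "1 / c"] by simp
  then have "Ck_on (Suc 0) R (\<lambda>t. \<chi> i j. l' (A t, D t) (jump i j, 0) / Vol M i)"
    by (rule Ck_on_matrix)
  moreover have "(\<chi> i j. l' (A t, D t) (jump i j, 0) / Vol M i) = fderiv_A M l (A t) (D t)" if "t \<in> R" for t
    using fderiv_A_eq[OF M A(2)[OF that] l'] A(2)[OF that] by simp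
  ultimately show "Ck_on (Suc 0) R (\<lambda>t. fderiv_A M l (A t) (D t))"
    by (rule Ck_on_cong)
  have "continuous_on R (\<lambda>t. \<chi> i. l' (A t, D t) (0, axis i 1) / Vol M i)"
    using Vol_pos[OF M] Ck_on_imp_continuous_on[OF part]
    by (intro continuous_intros) (auto simp: less_imp_neq[THEN not_sym])
  moreover have "fderiv_D M l (A t) (D t) = (\<chi> i. l' (A t, D t) (0, axis i 1) / Vol M i)" if "t \<in> R" for t
    using fderiv_D_eq[OF M A(2)[OF that] l'] A(2)[OF that] by simp
  ultimately show "continuous_on R (\<lambda>t. fderiv_D M l (A t) (D t))"
    by (simp cong: continuous_on_cong)
qed

section \<open>The fundamental lemma of the calculus of variations\<close>

lemma smooth_on_real_polynomial_scaleR: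
  fixes v :: "'a::euclidean_space" and p :: "real \<Rightarrow> real"
  assumes "real_polynomial_function p"
  shows "smooth_on S (\<lambda>t. p t *\<^sub>R v)"
proof -
  have "Ck_on k S (\<lambda>t. p t *\<^sub>R v)" for k
    using assms
  proof (induction k arbitrary: p v)
    case 0
    then show ?case
      by (auto intro!: continuous_intros continuous_on_polymonial_function simp: real_polynomial_function_eq)
  next
    case (Suc k)
    obtain p' where p': "real_polynomial_function p'" "\<And>x. (p has_real_derivative p' x) (at x)"
      using has_real_derivative_polynomial_function[OF Suc.prems] by blast
    have "((\<lambda>t. p t *\<^sub>R v) has_derivative (\<lambda>h. p' x *\<^sub>R (h *\<^sub>R v))) (at x within S)" for x
      using p'(2)[of x, THEN DERIV_subset, of S, unfolded has_field_derivative_def, THEN has_derivative_scaleR_left, of v]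
      by simp
    then show ?case
      using Suc.IH[OF p'(1)] by (auto intro!: exI[of _ "\<lambda>x h. p' x *\<^sub>R (h *\<^sub>R v)"])
  qed
  then show ?thesis
    by (simp add: smooth_on_def)
qed

text \<open>
  Orthogonality to \<open>w p\<close>, with \<open>w t = t (T - t)\<close> and \<open>p\<close> a polynomial uniformly close to \<open>g\<close>, makes
  the integral of \<open>w g\<^sup>2\<close> arbitrarily small. Since \<open>w\<close> is positive inside the interval, \<open>g\<close> vanishes
  there, and at the end points by continuity. Polynomials serve as test functions because their
  smoothness is immediate and vanishing at the end points is all that is required of them.
\<close>

lemma fundamental_lemma_polynomial:
  fixes g :: "real \<Rightarrow> real"
  assumes T: "0 < T" and g: "continuous_on {0..T} g"
    and orth: "\<And>p. real_polynomial_function p \<Longrightarrow> p 0 = 0 \<Longrightarrow> p T = 0 \<Longrightarrow> integral {0..T} (\<lambda>t. p t * g t) = 0"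
    and t: "t \<in> {0..T}"
  shows "g t = 0"
proof -
  define w where "w = (\<lambda>t. t * (T - t))"
  have w: "real_polynomial_function w"
    unfolding w_def by (intro real_polynomial_function.intros real_polynomial_function_diff) auto
  have wpos: "0 \<le> w t" if "t \<in> {0..T}" for t
    using that by (simp add: w_def)
  have wcont: "continuous_on {0..T} w"
    unfolding w_def by (intro continuous_intros)
  define C where "C = integral {0..T} (\<lambda>t. w t * \<bar>g t\<bar>)"
  define I where "I = integral {0..T} (\<lambda>t. w t * (g t)\<^sup>2)"
  have C0: "0 \<le> C"
    unfolding C_def using wpos by (intro integral_nonneg integrable_continuous_interval continuous_intros wcont g) auto
  have "I \<le> e * C" if e: "0 < e" for e
  proof -
    obtain p where p: "real_polynomial_function p" and pe: "\<And>t. t \<in> {0..T} \<Longrightarrow> \<bar>g t - p t\<bar> < e"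
      using Stone_Weierstrass_real_polynomial_function[OF compact_Icc g e] by blast
    have pcont: "continuous_on {0..T} p"
      using p by (simp add: continuous_on_polymonial_function real_polynomial_function_eq)
    have "integral {0..T} (\<lambda>t. (w t * p t) * g t) = 0"
      by (intro orth real_polynomial_function.intros(4) w p) (simp_all add: w_def)
    then have "I = integral {0..T} (\<lambda>t. w t * (g t)\<^sup>2 - (w t * p t) * g t)"
      unfolding I_def
      by (subst integral_diff) (auto intro!: integrable_continuous_interval continuous_intros wcont g pcont)
    also have "\<dots> \<le> integral {0..T} (\<lambda>t. e * (w t * \<bar>g t\<bar>))"
    proof (rule integral_le)
      fix t assume t: "t \<in> {0..T}"
      have "w t * (g t)\<^sup>2 - w t * p t * g t = w t * ((g t - p t) * g t)"
        by (simp add: power2_eq_square algebra_simps)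
      also have "\<dots> \<le> w t * (\<bar>g t - p t\<bar> * \<bar>g t\<bar>)"
        using wpos[OF t] by (intro mult_left_mono) (auto simp: abs_mult[symmetric])
      also have "\<dots> \<le> w t * (e * \<bar>g t\<bar>)"
        using wpos[OF t] pe[OF t] by (intro mult_left_mono mult_right_mono) auto
      finally show "w t * (g t)\<^sup>2 - w t * p t * g t \<le> e * (w t * \<bar>g t\<bar>)"
        by (simp add: ac_simps)
    qed (auto intro!: integrable_continuous_interval continuous_intros wcont g pcont)
    also have "\<dots> = e * C"
      by (simp add: C_def)
    finally show ?thesis .
  qed
  then have "I \<le> 0 + e" if "0 < e" for e
  proof -
    have "I \<le> e / (C + 1) * C"
      using that C0 by (intro \<open>\<And>e. 0 < e \<Longrightarrow> I \<le> e * C\<close>) simp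
    also have "\<dots> \<le> e"
      using that C0 by (simp add: field_simps)
    finally show ?thesis by simp
  qed
  then have "I \<le> 0"
    by (rule field_le_epsilon)
  moreover have "0 \<le> I"
    unfolding I_def using wpos by (intro integral_nonneg integrable_continuous_interval continuous_intros wcont g) auto
  ultimately have "integral {0..T} (\<lambda>t. w t * (g t)\<^sup>2) = 0"
    by (simp add: I_def)
  moreover have "continuous_on {0..T} (\<lambda>t. w t * (g t)\<^sup>2)"
    by (intro continuous_intros wcont g)
  ultimately have zero: "\<forall>t\<in>{0..T}. w t * (g t)\<^sup>2 = 0"
    using integral_eq_0_iff[of 0 T "\<lambda>t. w t * (g t)\<^sup>2"] T wpos by simp
  have "g t = 0" if t: "t \<in> {0<..<T}" for t
  proof -
    have "w t \<noteq> 0"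
      using t by (simp add: w_def)
    moreover have "w t * (g t)\<^sup>2 = 0"
      using t by (intro zero[rule_format]) simp
    ultimately show ?thesis
      by simp
  qed
  \<comment> \<open>The weight \<open>w\<close> vanishes at the end points and gives no information on \<open>g\<close> there.\<close>
  moreover have "closure {0<..<T} = {0..T}"
    using T by simp
  ultimately show ?thesis
    using continuous_constant_on_closure[of "{0<..<T}" g 0 t] g t by simp
qed

section \<open>The variational principle\<close>

definition euler_lagrange ::
  "('x, 'n::finite) mesh \<Rightarrow> (real^'n^'n \<Rightarrow> real^'n \<Rightarrow> real) \<Rightarrow> real \<Rightarrow>
     (real \<Rightarrow> real^'n^'n) \<Rightarrow> (real \<Rightarrow> real^'n) \<Rightarrow> real \<Rightarrow> real^'n^'n" where
  "euler_lagrange M l T A D t =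
     time_deriv T (\<lambda>s. fderiv_A M l (A s) (D s)) t
     + matrix_inv (Omega M) ** commutator (transpose (A t)) (Omega M ** fderiv_A M l (A t) (D t))
     + outer (D t) (fderiv_D M l (A t) (D t))"

text \<open>
  The pairing of \<open>L\<close> with \<open>B\<close> vanishes at both ends, so its time derivative has integral zero;
  subtracting the pairing with the Euler-Lagrange expression from that derivative leaves exactly the
  integrand of the first variation.
\<close>

lemma
  fixes M :: "('x, 'n::finite) mesh" and A B :: "real \<Rightarrow> real^'n^'n"
  assumes M: "is_mesh M" and T: "0 < T"
    and L: "Ck_on (Suc 0) {0..T} (\<lambda>t. fderiv_A M l (A t) (D t))"
    and F: "continuous_on {0..T} (\<lambda>t. fderiv_D M l (A t) (D t))"
    and A: "continuous_on {0..T} A" and D: "continuous_on {0..T} D"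
  shows continuous_on_euler_lagrange: "continuous_on {0..T} (euler_lagrange M l T A D)"
    and first_variation_by_parts: "Ck_on (Suc 0) {0..T} B \<Longrightarrow> B 0 = 0 \<Longrightarrow> B T = 0 \<Longrightarrow>
      integral {0..T} (\<lambda>t.
        pairing M (fderiv_A M l (A t) (D t)) (time_deriv T B t + commutator (B t) (A t)) +
        pairing0 M (fderiv_D M l (A t) (D t)) (- ((matrix_inv (Omega M) ** transpose (B t) ** Omega M) *v D t)))
      = - integral {0..T} (\<lambda>t. pairing M (euler_lagrange M l T A D t) (B t))"
proof -
  let ?L = "\<lambda>t. fderiv_A M l (A t) (D t)"
  let ?F = "\<lambda>t. fderiv_D M l (A t) (D t)"
  note L' = C1_curve_time_deriv[OF L T]
  show E: "continuous_on {0..T} (euler_lagrange M l T A D)"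
    unfolding euler_lagrange_def[abs_def] commutator_def
    by (intro continuous_intros L'(2) F A D Ck_on_imp_continuous_on[OF L]
        bounded_bilinear.continuous_on[OF bounded_bilinear_matrix_mult]
        bounded_bilinear.continuous_on[OF bounded_bilinear_outer]
        bounded_linear.continuous_on[OF bounded_linear_transpose])
  assume B: "Ck_on (Suc 0) {0..T} B" and B0: "B 0 = 0" and BT: "B T = 0"
  note B' = C1_curve_time_deriv[OF B T]
  let ?d = "\<lambda>t. pairing M (?L t) (time_deriv T B t) + pairing M (time_deriv T ?L t) (B t)"
  have "(?d has_integral pairing M (?L T) (B T) - pairing M (?L 0) (B 0)) {0..T}"
    using T by (intro fundamental_theorem_of_calculus)
      (auto intro!: bounded_bilinear.has_vector_derivative[OF bounded_bilinear_pairing] L'(1) B'(1))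
  then have d: "(?d has_integral 0) {0..T}"
    using B0 BT by (simp add: pairing_eq_sum)
  have "((\<lambda>t. pairing M (euler_lagrange M l T A D t) (B t)) has_integral
      integral {0..T} (\<lambda>t. pairing M (euler_lagrange M l T A D t) (B t))) {0..T}"
    by (intro integrable_integral integrable_continuous_interval
        bounded_bilinear.continuous_on[OF bounded_bilinear_pairing] E Ck_on_imp_continuous_on[OF B])
  from has_integral_diff[OF d this]
  have "((\<lambda>t. ?d t - pairing M (euler_lagrange M l T A D t) (B t)) has_integral
      - integral {0..T} (\<lambda>t. pairing M (euler_lagrange M l T A D t) (B t))) {0..T}"
    by simp
  moreover have "?d t - pairing M (euler_lagrange M l T A D t) (B t) =
        pairing M (?L t) (time_deriv T B t + commutator (B t) (A t)) +
        pairing0 M (?F t) (- ((matrix_inv (Omega M) ** transpose (B t) ** Omega M) *v D t))" for t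
    using pairing_adjoint[OF M, of "?L t" "B t" "A t" "?F t" "D t"]
    by (simp add: euler_lagrange_def pairing_add_left pairing_add_right)
  ultimately show "integral {0..T} (\<lambda>t.
        pairing M (?L t) (time_deriv T B t + commutator (B t) (A t)) +
        pairing0 M (?F t) (- ((matrix_inv (Omega M) ** transpose (B t) ** Omega M) *v D t)))
      = - integral {0..T} (\<lambda>t. pairing M (euler_lagrange M l T A D t) (B t))"
    by (simp add: integral_unique)
qed

text \<open>
  The passage from an integral condition over all admissible curves to pointwise equations, one for
  each pair of neighbouring cells. The test curves are \<open>p t\<close> times an exchange field with \<open>p\<close> a
  polynomial.
\<close>

lemma admissible_orthogonal_iff:
  fixes M :: "('x, 'n::finite) mesh" and E :: "real \<Rightarrow> real^'n^'n"
  assumes M: "is_mesh M" and T: "0 < T" and E: "continuous_on {0..T} E"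
  shows "(\<forall>B. smooth_on {0..T} B \<and> (\<forall>t\<in>{0..T}. B t \<in> constraint_S M \<inter> constraint_R M) \<and> B 0 = 0 \<and> B T = 0
            \<longrightarrow> integral {0..T} (\<lambda>t. pairing M (E t) (B t)) = 0)
     \<longleftrightarrow> (\<forall>t\<in>{0..T}. \<forall>i j. i \<in> nbrs M j \<longrightarrow> one_form_proj (E t) $ i $ j = 0)"
    (is "?orth \<longleftrightarrow> ?zero")
proof
  assume orth: ?orth
  show ?zero
  proof (intro ballI allI impI)
    fix t i j assume t: "t \<in> {0..T}" and ij: "i \<in> nbrs M j"
    have "pairing M (E t) (exchange M i j) = 0"
    proof (rule fundamental_lemma_polynomial[OF T _ _ t])
      show "continuous_on {0..T} (\<lambda>t. pairing M (E t) (exchange M i j))"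
        by (intro bounded_bilinear.continuous_on[OF bounded_bilinear_pairing] E continuous_on_const)
      fix p :: "real \<Rightarrow> real"
      assume "real_polynomial_function p" "p 0 = 0" "p T = 0"
      then show "integral {0..T} (\<lambda>t. p t * pairing M (E t) (exchange M i j)) = 0"
        using orth[rule_format, of "\<lambda>t. p t *\<^sub>R exchange M i j"] exchange_admissible[OF M ij]
        by (simp add: smooth_on_real_polynomial_scaleR admissible_scaleR[simplified] pairing_scaleR_right)
    qed
    then show "one_form_proj (E t) $ i $ j = 0"
      by (simp add: pairing_exchange[OF M])
  qed
next
  assume zero: ?zero
  show ?orth
  proof (intro allI impI)
    fix B assume B: "smooth_on {0..T} B \<and> (\<forall>t\<in>{0..T}. B t \<in> constraint_S M \<inter> constraint_R M) \<and> B 0 = 0 \<and> B T = 0"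
    have "pairing M (E t) (B t) = 0" if t: "t \<in> {0..T}" for t
    proof -
      have "one_form_proj (E t) $ i $ j * B t $ i $ j = 0" for i j
        using zero B t nbrs_sym[of i M j] by (cases "i \<in> nbrs M j") (auto simp: constraint_S_def)
      then have "pairing M (one_form_proj (E t)) (B t) = 0"
        by (simp only: pairing_eq_sum mult.assoc mult_zero_right sum.neutral_const)
      with B t show ?thesis
        by (simp add: pairing_one_form_proj)
    qed
    then have "integral {0..T} (\<lambda>t. pairing M (E t) (B t)) = integral {0..T} (\<lambda>t. 0)"
      by (intro integral_cong) auto
    then show "integral {0..T} (\<lambda>t. pairing M (E t) (B t)) = 0"
      by simp
  qed
qed

section \<open>The continuity equation\<close>

text \<open>
  Transport means that \<open>q\<^sup>T Omega D\<close> stays equal to \<open>Omega D0\<close>. Differentiating this identity by the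
  product rule and multiplying by \<open>Omega\<inverse>\<close> and the inverse of \<open>q\<^sup>T\<close> gives the equation without having
  to differentiate the inverse of \<open>q\<close>.
\<close>

lemma transported_density_continuity:
  fixes M :: "('x, 'n::finite) mesh" and q :: "real \<Rightarrow> real^'n^'n"
  assumes M: "is_mesh M" and T: "0 < T"
    and q: "Ck_on (Suc 0) {0..T} q" and inv: "\<And>t. t \<in> {0..T} \<Longrightarrow> invertible (q t)"
    and D: "Ck_on (Suc 0) {0..T} D"
    and Dq: "\<And>t. t \<in> {0..T} \<Longrightarrow> D t = dens_act M D0 (matrix_inv (q t))"
    and t: "t \<in> {0..T}"
  shows "time_deriv T D t
    + (matrix_inv (Omega M) ** transpose (time_deriv T q t ** matrix_inv (q t)) ** Omega M) *v D t = 0"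
proof -
  let ?W = "matrix_inv (Omega M)"
  let ?D' = "time_deriv T D t" and ?q' = "time_deriv T q t"
  note W = matrix_inv_works[OF invertible_Omega[OF M]]
  have const: "transpose (q s) *v (Omega M *v D s) = Omega M *v D0" if "s \<in> {0..T}" for s
  proof -
    have "Omega M *v D s = transpose (matrix_inv (q s)) *v (Omega M *v D0)"
      by (simp add: Dq[OF that] dens_act_def matrix_vector_mul_assoc matrix_mul_assoc W)
    moreover have "transpose (q s) ** transpose (matrix_inv (q s)) = mat 1"
      by (simp add: matrix_transpose_mul[symmetric] matrix_inv_works(2)[OF inv[OF that]] transpose_mat)
    ultimately show ?thesis
      by (simp add: matrix_vector_mul_assoc matrix_mul_assoc)
  qed
  have "((\<lambda>s. transpose (q s) *v (Omega M *v D s)) has_vector_derivative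
      transpose (q t) *v (Omega M *v ?D') + transpose ?q' *v (Omega M *v D t)) (at t within {0..T})"
    by (intro bounded_bilinear.has_vector_derivative[OF bounded_bilinear_matrix_vector_mult]
        bounded_linear.has_vector_derivative[OF bounded_linear_transpose]
        bounded_linear.has_vector_derivative[OF matrix_vector_mul_bounded_linear]
        C1_curve_time_deriv(1)[OF q T t] C1_curve_time_deriv(1)[OF D T t])
  moreover have "((\<lambda>s. transpose (q s) *v (Omega M *v D s)) has_vector_derivative 0) (at t within {0..T})"
    using has_vector_derivative_transform[OF t const has_vector_derivative_const] by simp
  ultimately have 0: "transpose (q t) *v (Omega M *v ?D') + transpose ?q' *v (Omega M *v D t) = 0"
    by (rule trans[OF vector_derivative_within_closed_interval[OF T t, symmetric]
          vector_derivative_within_closed_interval[OF T t]])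
  let ?Q = "transpose (matrix_inv (q t))"
  have Q: "?Q ** transpose (q t) = mat 1"
    by (simp add: matrix_transpose_mul[symmetric] matrix_inv_works(1)[OF inv[OF t]] transpose_mat)
  have "0 = ?W *v (?Q *v (transpose (q t) *v (Omega M *v ?D') + transpose ?q' *v (Omega M *v D t)))"
    by (simp only: 0 matrix_vector_mult_0_right)
  also have "\<dots> = (?W ** (?Q ** transpose (q t)) ** Omega M) *v ?D' + (?W ** (?Q ** transpose ?q') ** Omega M) *v D t"
    by (simp only: matrix_vector_right_distrib matrix_vector_mul_assoc matrix_mul_assoc)
  also have "\<dots> = ?D' + (?W ** transpose (?q' ** matrix_inv (q t)) ** Omega M) *v D t"
    by (simp add: Q W matrix_transpose_mul del: transpose_matrix_vector)
  finally show ?thesis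
    by simp
qed

theorem theorem2p4:
  fixes M :: "('x, 'n::finite) mesh"
    and l :: "real^'n^'n \<Rightarrow> real^'n \<Rightarrow> real"
    and T :: real
    and A :: "real \<Rightarrow> real^'n^'n"
    and D :: "real \<Rightarrow> real^'n"
  assumes "is_mesh M"
    and "smooth_on (discrete_fields \<times> UNIV) (\<lambda>(X, Y). l X Y)"
    and "0 < T"
    and "smooth_on {0..T} A"
    and "\<forall>t\<in>{0..T}. A t \<in> constraint_S M \<inter> constraint_R M"
    and "smooth_on {0..T} D"
  shows "(EPdA_critical M l T A D \<longleftrightarrow>
           (\<forall>t\<in>{0..T}. \<forall>i j. i \<in> nbrs M j \<longrightarrow>
              one_form_proj
                (time_deriv T (\<lambda>s. fderiv_A M l (A s) (D s)) t
                 + matrix_inv (Omega M) **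
                     commutator (transpose (A t)) (Omega M ** fderiv_A M l (A t) (D t))
                 + outer (D t) (fderiv_D M l (A t) (D t))) $ i $ j = 0))
       \<and> (\<forall>q D0.
            smooth_on {0..T} q \<and>
            (\<forall>t\<in>{0..T}. q t \<in> discrete_diffeos \<and>
               D t = dens_act M D0 (matrix_inv (q t)) \<and>
               A t = time_deriv T q t ** matrix_inv (q t)) \<longrightarrow>
            (\<forall>t\<in>{0..T}. time_deriv T D t
               + (matrix_inv (Omega M) ** transpose (A t) ** Omega M) *v D t = 0))"
proof (intro conjI allI impI ballI)
  have C1: "Ck_on (Suc 0) {0..T} A" "Ck_on (Suc 0) {0..T} D"
      "Ck_on (Suc (Suc 0)) (discrete_fields \<times> UNIV) (\<lambda>(X, Y). l X Y)"
    using assms(2,4,6) unfolding smooth_on_def by blast+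
  have fields: "A t \<in> discrete_fields" if "t \<in> {0..T}" for t
    using assms(5) that by (auto simp: constraint_S_def)
  have LF: "Ck_on (Suc 0) {0..T} (\<lambda>t. fderiv_A M l (A t) (D t))"
      "continuous_on {0..T} (\<lambda>t. fderiv_D M l (A t) (D t))"
    using fderivs_along_curve[OF assms(1) C1(3,1) _ C1(2)] fields by blast+
  note cont = Ck_on_imp_continuous_on[OF C1(1)] Ck_on_imp_continuous_on[OF C1(2)]
  note variation = first_variation_by_parts[OF assms(1,3) LF cont]
  have "EPdA_critical M l T A D \<longleftrightarrow>
      (\<forall>B. smooth_on {0..T} B \<and> (\<forall>t\<in>{0..T}. B t \<in> constraint_S M \<inter> constraint_R M) \<and> B 0 = 0 \<and> B T = 0
         \<longrightarrow> integral {0..T} (\<lambda>t. pairing M (euler_lagrange M l T A D t) (B t)) = 0)"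
    unfolding EPdA_critical_def
  proof (intro arg_cong[of _ _ All] ext imp_cong refl)
    fix B
    assume "smooth_on {0..T} B \<and> (\<forall>t\<in>{0..T}. B t \<in> constraint_S M \<inter> constraint_R M) \<and> B 0 = 0 \<and> B T = 0"
    then have "Ck_on (Suc 0) {0..T} B" "B 0 = 0" "B T = 0"
      unfolding smooth_on_def by blast+
    from variation[OF this] show "(integral {0..T} (\<lambda>t.
        pairing M (fderiv_A M l (A t) (D t)) (time_deriv T B t + commutator (B t) (A t)) +
        pairing0 M (fderiv_D M l (A t) (D t))
          (- ((matrix_inv (Omega M) ** transpose (B t) ** Omega M) *v D t))) = 0)
      = (integral {0..T} (\<lambda>t. pairing M (euler_lagrange M l T A D t) (B t)) = 0)"
      by simp
  qed
  also have "\<dots> \<longleftrightarrow> (\<forall>t\<in>{0..T}. \<forall>i j. i \<in> nbrs M j \<longrightarrow> one_form_proj (euler_lagrange M l T A D t) $ i $ j = 0)"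
    by (rule admissible_orthogonal_iff[OF assms(1,3) continuous_on_euler_lagrange[OF assms(1,3) LF cont]])
  finally show "EPdA_critical M l T A D \<longleftrightarrow>
           (\<forall>t\<in>{0..T}. \<forall>i j. i \<in> nbrs M j \<longrightarrow>
              one_form_proj
                (time_deriv T (\<lambda>s. fderiv_A M l (A s) (D s)) t
                 + matrix_inv (Omega M) **
                     commutator (transpose (A t)) (Omega M ** fderiv_A M l (A t) (D t))
                 + outer (D t) (fderiv_D M l (A t) (D t))) $ i $ j = 0)"
    unfolding euler_lagrange_def .
next
  fix q D0 t
  assume q: "smooth_on {0..T} q \<and>
            (\<forall>t\<in>{0..T}. q t \<in> discrete_diffeos \<and>
               D t = dens_act M D0 (matrix_inv (q t)) \<and>
               A t = time_deriv T q t ** matrix_inv (q t))"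
    and t: "t \<in> {0..T}"
  have "invertible (q s)" if "s \<in> {0..T}" for s
    using q that unfolding discrete_diffeos_def invertible_det_nz by fastforce
  moreover have "Ck_on (Suc 0) {0..T} q" "Ck_on (Suc 0) {0..T} D"
    using q assms(6) unfolding smooth_on_def by blast+
  ultimately show "time_deriv T D t + (matrix_inv (Omega M) ** transpose (A t) ** Omega M) *v D t = 0"
    using transported_density_continuity[OF assms(1,3), of q D D0 t] q t by simp
qed

end
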